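(* Let $\alpha>-1$, $\beta>0$, and let $f=h+\overline{g}\in\mathcal{B}_{\mathcal{H}}^0(\alpha,\beta)$ with $h(z)=z+\sum_{n=2}^\infty a_nz^n$ and $g(z)=\sum_{n=2}^\infty b_nz^n$. Then for every $n\ge2$, $$|a_n|\le\frac{\beta}{n(n+\alpha-1)}\quad\text{and}\quad |b_n|\le\frac{\beta}{n(n+\alpha-1)}.$$ Both inequalities are sharp, i.e. for every $n\ge 2$ each of them is attained with equality by some function of $\mathcal{B}_{\mathcal{H}}^0(\alpha,\beta)$.
   Context: $\mathbb{D}=\{z\in\mathbb{C}:|z|<1\}$. $\mathcal{H}^0$ is the class of harmonic mappings $f=h+\overline{g}$ in $\mathbb{D}$, where $h,g$ are analytic in $\mathbb{D}$ with $h(0)=g(0)=0$, $h'(0)=1$ and $g'(0)=0$. For $\alpha>-1$ and $\beta>0$, $\mathcal{B}_{\mathcal{H}}^0(\alpha,\beta)$ is the set of $f=h+\overline{g}\in\mathcal{H}^0$ such that $|zh''(z)+\alpha(h'(z)-1)|\le \beta-|zg''(z)+\alpha g'(z)|$ for all $z\in\mathbb{D}$. *)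

theory Defs
  imports "HOL-Complex_Analysis.Complex_Analysis"
begin

abbreviation unit_disc :: "complex set" where
  "unit_disc \<equiv> ball 0 1"

definition canonical_rep :: "(complex \<Rightarrow> complex) \<Rightarrow> (complex \<Rightarrow> complex) \<Rightarrow> (complex \<Rightarrow> complex) \<Rightarrow> bool" where
  "canonical_rep f h g \<longleftrightarrow>
     h holomorphic_on unit_disc \<and> g holomorphic_on unit_disc \<and> h 0 = 0 \<and> g 0 = 0 \<and>
     (\<forall>z\<in>unit_disc. f z = h z + cnj (g z))"

text \<open>Functions are total, so \<open>f\<close>, \<open>h\<close>, \<open>g\<close> are only constrained on the unit disc;
  their values elsewhere are irrelevant.\<close>

definition H0 :: "(complex \<Rightarrow> complex) set" where
  "H0 = {f. \<exists>h g. canonical_rep f h g \<and> deriv h 0 = 1 \<and> deriv g 0 = 0}"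

text \<open>The parts \<open>h\<close> and \<open>g\<close> are determined by \<open>f\<close> on the disc (lemma
  \<open>canonical_rep_unique\<close> below), so the existential quantifier over them in the
  next definition involves no choice.\<close>

definition B0 :: "real \<Rightarrow> real \<Rightarrow> (complex \<Rightarrow> complex) set" where
  "B0 \<alpha> \<beta> = {f \<in> H0. \<exists>h g. canonical_rep f h g \<and>
     (\<forall>z\<in>unit_disc.
        cmod (z * deriv (deriv h) z + of_real \<alpha> * (deriv h z - 1))
          \<le> \<beta> - cmod (z * deriv (deriv g) z + of_real \<alpha> * deriv g z))}"

text \<open>\<open>F z\<close> is the sum of \<open>c n * z ^ n\<close> over \<open>n \<ge> 2\<close>; \<open>c 0\<close> and \<open>c 1\<close> are not used.\<close>

definition series_from_2 :: "(complex \<Rightarrow> complex) \<Rightarrow> (nat \<Rightarrow> complex) \<Rightarrow> bool" where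
  "series_from_2 F c \<longleftrightarrow> (\<forall>z\<in>unit_disc. (\<lambda>k. c (k + 2) * z ^ (k + 2)) sums F z)"

lemma real_holomorphic_const:
  assumes "u holomorphic_on unit_disc" "\<And>z. z \<in> unit_disc \<Longrightarrow> Im (u z) = 0" "z \<in> unit_disc"
  shows "u z = u 0"
proof (rule ccontr)
  assume ne: "u z \<noteq> u 0"
  have nc: "\<not> u constant_on unit_disc"
    using ne assms(3) unfolding constant_on_def by (metis centre_in_ball zero_less_one)
  have "open (u ` unit_disc)"
    by (rule open_mapping_thm[OF assms(1) _ _ _ _ nc]) auto
  moreover have "u 0 \<in> u ` unit_disc" by auto
  ultimately obtain e where e: "e > 0" "ball (u 0) e \<subseteq> u ` unit_disc"
    by (meson open_contains_ball)
  have "u 0 + of_real (e/2) * \<i> \<in> ball (u 0) e"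
    using e by (simp add: dist_norm norm_mult)
  then obtain w where "w \<in> unit_disc" "u w = u 0 + of_real (e/2) * \<i>"
    using e(2) by (metis (no_types, lifting) imageE subsetD)
  then have "Im (u 0) + e/2 = 0" using assms(2)[of w] by simp
  then show False using assms(2)[of 0] e(1) by simp
qed

lemma canonical_rep_unique:
  assumes "canonical_rep f h g" "canonical_rep f h' g'" "z \<in> unit_disc"
  shows "h z = h' z" "g z = g' z"
proof -
  define d where "d = (\<lambda>z. h z - h' z)"
  define e where "e = (\<lambda>z. g' z - g z)"
  have hol: "d holomorphic_on unit_disc" "e holomorphic_on unit_disc"
    using assms unfolding canonical_rep_def d_def e_def by (auto intro!: holomorphic_intros)
  have eq: "d w = cnj (e w)" if "w \<in> unit_disc" for w
  proof -
    have "h w + cnj (g w) = h' w + cnj (g' w)"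
      using assms that unfolding canonical_rep_def by metis
    then show ?thesis unfolding d_def e_def by (simp add: algebra_simps)
  qed
  have z0: "d 0 = 0" "e 0 = 0" using assms unfolding canonical_rep_def d_def e_def by auto
  have "d z + e z = d 0 + e 0"
    by (rule real_holomorphic_const[where u = "\<lambda>z. d z + e z"])
      (use hol eq assms in \<open>auto intro!: holomorphic_intros\<close>)
  moreover have "\<i> * (d z - e z) = \<i> * (d 0 - e 0)"
    by (rule real_holomorphic_const[where u = "\<lambda>z. \<i> * (d z - e z)"])
      (use hol eq assms in \<open>auto intro!: holomorphic_intros\<close>)
  ultimately have "d z = 0" "e z = 0" using z0 by (auto simp: add_eq_0_iff)
  then show "h z = h' z" "g z = g' z" by (auto simp: d_def e_def)
qed

end

theory Submission
  imports Defs
begin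

text \<open>If \<open>F\<close> has Taylor coefficients \<open>c\<close>, the \<open>n-1\<close>-st Taylor coefficient of
  \<open>z F'' + \<alpha> F'\<close> is \<open>n (n + \<alpha> - 1) c\<^sub>n\<close>. For \<open>h\<close> (after subtracting
  the constant \<open>\<alpha>\<close>, which only affects the constant term) and for \<open>g\<close> this function is bounded
  by \<open>\<beta>\<close> on the disc, so Cauchy's inequality gives the estimate. Equality holds
  when that function is \<open>\<beta> z\<^sup>n\<^sup>-\<^sup>1\<close>, that is, for a single term \<open>z\<^sup>n\<close>.\<close>

text \<open>Cauchy's inequality on the circle of radius \<open>r < 1\<close> gives the bound up to a
  factor \<open>r ^ k\<close>. The limit \<open>r\<close> to 1 from the left removes it, so no
  continuity of \<open>P\<close> on the closed disc is required.\<close>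

lemma norm_coeff_le_of_bounded_on_disc:
  assumes hol: "P holomorphic_on unit_disc"
    and bound: "\<And>z. z \<in> unit_disc \<Longrightarrow> cmod (P z) \<le> B"
    and exp: "P has_fps_expansion A"
  shows "cmod (fps_nth A k) \<le> B"
proof -
  have "cmod (fps_nth A k) * r ^ k \<le> B" if r: "0 < r" "r < 1" for r :: real
  proof -
    have sub: "cball 0 r \<subseteq> unit_disc" using r by auto
    have "cmod ((deriv ^^ k) P 0) \<le> fact k * B / r ^ k"
    proof (rule Cauchy_inequality)
      show "P holomorphic_on ball 0 r"
        using hol sub ball_subset_cball holomorphic_on_subset by blast
      show "continuous_on (cball 0 r) P"
        using hol sub holomorphic_on_imp_continuous_on holomorphic_on_subset by blast
    qed (use r bound in auto)
    then have "cmod ((deriv ^^ k) P 0) / fact k * r ^ k \<le> B"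
      using r by (simp add: field_simps)
    then show ?thesis
      by (simp add: fps_nth_fps_expansion[OF exp] norm_divide)
  qed
  then have "eventually (\<lambda>r. cmod (fps_nth A k) * r ^ k \<le> B) (at_left (1::real))"
    by (intro eventually_at_leftI[of 0]) auto
  moreover have "((\<lambda>r. cmod (fps_nth A k) * r ^ k) \<longlongrightarrow> cmod (fps_nth A k) * 1 ^ k) (at_left (1::real))"
    by (intro tendsto_intros)
  ultimately have "cmod (fps_nth A k) * 1 ^ k \<le> B"
    using tendsto_upperbound trivial_limit_at_left_real by blast
  then show ?thesis by simp
qed

text \<open>The parameter \<open>d\<close> treats both parts of the mapping at once:
  \<open>d = 1\<close> for the analytic part, \<open>d = 0\<close> for the co-analytic part.\<close>

lemma coeff_bound:
  fixes \<alpha> :: real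
  assumes \<alpha>: "\<alpha> > -1"
    and hol: "F holomorphic_on unit_disc"
    and bound: "\<And>z. z \<in> unit_disc \<Longrightarrow>
      cmod (z * deriv (deriv F) z + of_real \<alpha> * (deriv F z - d)) \<le> \<beta>"
    and exp: "F has_fps_expansion A"
    and n: "n \<ge> 2"
  shows "cmod (fps_nth A n) \<le> \<beta> / (real n * (real n + \<alpha> - 1))"
proof -
  define P where "P = (\<lambda>z. z * deriv (deriv F) z + of_real \<alpha> * (deriv F z - d))"
  define C where "C = fps_X * fps_deriv (fps_deriv A) + fps_const (of_real \<alpha>) * (fps_deriv A - fps_const d)"
  have "P holomorphic_on unit_disc"
    unfolding P_def by (intro holomorphic_intros hol open_ball)
  moreover have "P has_fps_expansion C"
    unfolding P_def C_def by (intro fps_expansion_intros exp)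
  ultimately have "cmod (fps_nth C (n - 1)) \<le> \<beta>"
    using norm_coeff_le_of_bounded_on_disc bound unfolding P_def by blast
  moreover obtain m where m: "n = Suc (Suc m)"
    using n by (metis add_2_eq_Suc le_Suc_ex)
  \<comment> \<open>The index \<open>n - 1 = Suc m\<close> is positive, so \<open>d\<close> drops
    out. The two remaining terms contribute the factors \<open>n * (n - 1)\<close> and
    \<open>\<alpha> * n\<close>.\<close>
  have "fps_nth C (n - 1) = of_real (real n * (real n + \<alpha> - 1)) * fps_nth A n"
    unfolding C_def m by (simp add: algebra_simps)
  moreover have pos: "real n * (real n + \<alpha> - 1) > 0"
    using n \<alpha> by (intro mult_pos_pos) auto
  ultimately have "(real n * (real n + \<alpha> - 1)) * cmod (fps_nth A n) \<le> \<beta>"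
    by (metis abs_of_pos norm_mult norm_of_real)
  then show ?thesis
    using pos by (simp add: pos_le_divide_eq mult.commute)
qed

text \<open>The zeros at indices 0 and 1 turn the sum from index 2 on into a full power series with
  the same value on the disc.\<close>

lemma series_from_2_has_fps_expansion:
  assumes "series_from_2 F c"
  shows "F has_fps_expansion Abs_fps (\<lambda>n. if n < 2 then 0 else c n)"
proof (rule has_fps_expansionI)
  have "(\<lambda>n. fps_nth (Abs_fps (\<lambda>n. if n < 2 then 0 else c n)) n * z ^ n) sums F z"
    if "z \<in> unit_disc" for z
    using assms that sums_iff_shift[of "\<lambda>n. (if n < 2 then 0 else c n) * z ^ n" 2 "F z"]
    by (simp add: series_from_2_def numeral_2_eq_2)
  then show "\<forall>\<^sub>F z in nhds 0.
      (\<lambda>n. fps_nth (Abs_fps (\<lambda>n. if n < 2 then 0 else c n)) n * z ^ n) sums F z"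
    by (intro eventually_nhds_in_open[THEN eventually_mono, of unit_disc]) auto
qed

lemma series_from_2_monomial:
  assumes "n \<ge> 2"
  shows "series_from_2 (\<lambda>z. c * z ^ n) (\<lambda>k. if k = n then c else 0)"
proof -
  obtain m where m: "n = m + 2"
    using assms by (metis add.commute le_Suc_ex)
  have "(\<lambda>k. (if k + 2 = n then c else 0) * z ^ (k + 2)) sums (c * z ^ n)" for z :: complex
    using sums_single[of m "\<lambda>k. c * z ^ (k + 2)"] by (simp add: m if_distrib[of "\<lambda>x. x * _"] cong: if_cong)
  then show ?thesis by (simp add: series_from_2_def)
qed

lemma canonical_rep_monomials:
  assumes "n \<ge> 2"
  shows "canonical_rep (\<lambda>z. z + A * z ^ n + cnj (B * z ^ n)) (\<lambda>z. z + A * z ^ n) (\<lambda>z. B * z ^ n)"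
  using assms unfolding canonical_rep_def by (auto intro!: holomorphic_intros)

text \<open>The two expressions in the definition of \<open>B0\<close> reduce to
  \<open>A * N * z ^ (n - 1)\<close> and \<open>B * N * z ^ (n - 1)\<close> with
  \<open>N = n * (n + \<alpha> - 1) > 0\<close>. On the disc their moduli add up to at most
  \<open>(cmod A + cmod B) * N\<close>.\<close>

lemma monomials_in_B0:
  fixes \<alpha> \<beta> :: real
  assumes n: "n \<ge> 2" and \<alpha>: "\<alpha> > -1"
    and AB: "(cmod A + cmod B) * (real n * (real n + \<alpha> - 1)) \<le> \<beta>"
  shows "(\<lambda>z. z + A * z ^ n + cnj (B * z ^ n)) \<in> B0 \<alpha> \<beta>"
proof -
  define N where "N = real n * (real n + \<alpha> - 1)"
  obtain m where m: "n = Suc (Suc m)"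
    using n by (metis add_2_eq_Suc le_Suc_ex)
  have N: "N > 0" unfolding N_def using n \<alpha> by (intro mult_pos_pos) auto
  \<comment> \<open>The shape \<open>a * z + c * z ^ n\<close> covers \<open>z + A * z ^ n\<close>
    with \<open>a = 1\<close> and \<open>B * z ^ n\<close> with \<open>a = 0\<close>.\<close>
  have d1: "deriv (\<lambda>z. a * z + c * z ^ n) = (\<lambda>z. a + c * (of_nat n * z ^ (n - 1)))" for a c :: complex
    by (rule ext, rule DERIV_imp_deriv) (auto intro!: derivative_eq_intros)
  have d2: "deriv (\<lambda>z. a + c * (of_nat n * z ^ (n - 1))) = (\<lambda>z. c * (of_nat n * (of_nat (n - 1) * z ^ (n - 2))))"
    for a c :: complex
    by (rule ext, rule DERIV_imp_deriv) (auto intro!: derivative_eq_intros simp: numeral_2_eq_2)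
  have P: "cmod (z * deriv (deriv (\<lambda>z. a * z + c * z ^ n)) z
        + of_real \<alpha> * (deriv (\<lambda>z. a * z + c * z ^ n) z - a)) \<le> cmod c * N"
    if "z \<in> unit_disc" for a c z
  proof -
    have "z * deriv (deriv (\<lambda>z. a * z + c * z ^ n)) z
        + of_real \<alpha> * (deriv (\<lambda>z. a * z + c * z ^ n) z - a) = c * of_real N * z ^ (n - 1)"
      unfolding d1 d2 by (simp add: N_def m algebra_simps)
    moreover have "cmod (z ^ (n - 1)) \<le> 1"
      using that by (simp add: norm_power power_le_one)
    ultimately show ?thesis
      using N by (simp add: norm_mult mult_left_le)
  qed
  have "cmod (z * deriv (deriv (\<lambda>z. z + A * z ^ n)) z + of_real \<alpha> * (deriv (\<lambda>z. z + A * z ^ n) z - 1))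
      \<le> \<beta> - cmod (z * deriv (deriv (\<lambda>z. B * z ^ n)) z + of_real \<alpha> * deriv (\<lambda>z. B * z ^ n) z)"
    if "z \<in> unit_disc" for z
    using P[OF that, of 1 A] P[OF that, of 0 B] AB by (simp add: N_def algebra_simps)
  moreover have "deriv (\<lambda>z. z + A * z ^ n) 0 = 1" "deriv (\<lambda>z. B * z ^ n) 0 = 0"
    using d1[of 1 A] d1[of 0 B] m by simp_all
  ultimately show ?thesis
    using canonical_rep_monomials[OF n] unfolding B0_def H0_def by blast
qed

text \<open>Membership in \<open>B0\<close> supplies its own representation \<open>h'\<close>,
  \<open>g'\<close>. By uniqueness it agrees with \<open>h\<close>, \<open>g\<close> on the disc, so
  the given series also expand \<open>h'\<close> and \<open>g'\<close>. Each of the two moduli is at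
  most \<open>\<beta>\<close>, since the other one is nonnegative.\<close>

lemma B0_coeff_bounds:
  fixes \<alpha> \<beta> :: real
  assumes \<alpha>: "\<alpha> > -1" and f: "f \<in> B0 \<alpha> \<beta>" and rep: "canonical_rep f h g"
    and a: "series_from_2 (\<lambda>z. h z - z) a" and b: "series_from_2 g b" and n: "n \<ge> 2"
  shows "cmod (a n) \<le> \<beta> / (real n * (real n + \<alpha> - 1))"
    and "cmod (b n) \<le> \<beta> / (real n * (real n + \<alpha> - 1))"
proof -
  obtain h' g' where rep': "canonical_rep f h' g'"
    and bound: "\<And>z. z \<in> unit_disc \<Longrightarrow>
        cmod (z * deriv (deriv h') z + of_real \<alpha> * (deriv h' z - 1))
          \<le> \<beta> - cmod (z * deriv (deriv g') z + of_real \<alpha> * deriv g' z)"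
    using f unfolding B0_def by blast
  have hol: "h' holomorphic_on unit_disc" "g' holomorphic_on unit_disc"
    using rep' by (auto simp: canonical_rep_def)
  have "series_from_2 (\<lambda>z. h' z - z) a" "series_from_2 g' b"
    using a b canonical_rep_unique[OF rep rep'] by (simp_all add: series_from_2_def)
  note exps = this[THEN series_from_2_has_fps_expansion]
  \<comment> \<open>Adding \<open>z\<close> back changes only the coefficient of index 1, hence none
    with \<open>n \<ge> 2\<close>.\<close>
  have "(\<lambda>z. (h' z - z) + z) has_fps_expansion Abs_fps (\<lambda>n. if n < 2 then 0 else a n) + fps_X"
    by (intro fps_expansion_intros exps)
  then have "h' has_fps_expansion Abs_fps (\<lambda>n. if n < 2 then 0 else a n) + fps_X"
    by simp
  moreover have "cmod (z * deriv (deriv h') z + of_real \<alpha> * (deriv h' z - 1)) \<le> \<beta>"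
    if "z \<in> unit_disc" for z
    using bound[OF that] norm_ge_zero order_trans by (smt (verit))
  ultimately show "cmod (a n) \<le> \<beta> / (real n * (real n + \<alpha> - 1))"
    using coeff_bound[OF \<alpha> hol(1), of 1 \<beta>] n by fastforce
  have "cmod (z * deriv (deriv g') z + of_real \<alpha> * (deriv g' z - 0)) \<le> \<beta>"
    if "z \<in> unit_disc" for z
    using bound[OF that] norm_ge_zero by (smt (verit) diff_zero)
  then show "cmod (b n) \<le> \<beta> / (real n * (real n + \<alpha> - 1))"
    using coeff_bound[OF \<alpha> hol(2), of 0 \<beta>] exps(2) n by fastforce
qed

theorem theorem2p4:
  fixes \<alpha> \<beta> :: real
  assumes "\<alpha> > -1" and "\<beta> > 0"
  shows
    "(\<forall>f h g a b.
        f \<in> B0 \<alpha> \<beta> \<and> canonical_rep f h g \<and>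
        series_from_2 (\<lambda>z. h z - z) a \<and> series_from_2 g b \<longrightarrow>
        (\<forall>n\<ge>2. cmod (a n) \<le> \<beta> / (real n * (real n + \<alpha> - 1)) \<and>
               cmod (b n) \<le> \<beta> / (real n * (real n + \<alpha> - 1)))) \<and>
     (\<forall>n\<ge>2. \<exists>f\<in>B0 \<alpha> \<beta>. \<exists>h g a b. canonical_rep f h g \<and>
        series_from_2 (\<lambda>z. h z - z) a \<and> series_from_2 g b \<and>
        cmod (a n) = \<beta> / (real n * (real n + \<alpha> - 1))) \<and>
     (\<forall>n\<ge>2. \<exists>f\<in>B0 \<alpha> \<beta>. \<exists>h g a b. canonical_rep f h g \<and>
        series_from_2 (\<lambda>z. h z - z) a \<and> series_from_2 g b \<and>
        cmod (b n) = \<beta> / (real n * (real n + \<alpha> - 1)))"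
proof -
  \<comment> \<open>Both \<open>n\<close>-th coefficients can be prescribed as long as their moduli
    respect the joint bound; sharpness of each estimate follows by setting the other coefficient to
    0.\<close>
  have extremal: "\<exists>f\<in>B0 \<alpha> \<beta>. \<exists>h g a b. canonical_rep f h g \<and>
        series_from_2 (\<lambda>z. h z - z) a \<and> series_from_2 g b \<and> a n = A \<and> b n = B"
    if n: "n \<ge> 2" and "(cmod A + cmod B) * (real n * (real n + \<alpha> - 1)) \<le> \<beta>" for n A B
  proof (intro bexI exI conjI)
    show "canonical_rep (\<lambda>z. z + A * z ^ n + cnj (B * z ^ n)) (\<lambda>z. z + A * z ^ n) (\<lambda>z. B * z ^ n)"
      using n by (rule canonical_rep_monomials)
    show "series_from_2 (\<lambda>z. z + A * z ^ n - z) (\<lambda>k. if k = n then A else 0)"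
      using series_from_2_monomial[OF n] by simp
    show "series_from_2 (\<lambda>z. B * z ^ n) (\<lambda>k. if k = n then B else 0)"
      using n by (rule series_from_2_monomial)
    show "(\<lambda>z. z + A * z ^ n + cnj (B * z ^ n)) \<in> B0 \<alpha> \<beta>"
      using that assms(1) by (intro monomials_in_B0)
  qed simp_all
  define c where "c = (\<lambda>n. \<beta> / (real n * (real n + \<alpha> - 1)))"
  have c: "c n * (real n * (real n + \<alpha> - 1)) = \<beta>" "c n > 0" if "n \<ge> 2" for n
  proof -
    have "real n * (real n + \<alpha> - 1) > 0"
      using that assms(1) by (intro mult_pos_pos) auto
    then show "c n * (real n * (real n + \<alpha> - 1)) = \<beta>" "c n > 0"
      using assms(2) by (simp_all only: c_def divide_pos_pos nonzero_eq_divide_eq[symmetric] less_imp_neq[symmetric] not_False_eq_True)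
  qed
  have "\<exists>f\<in>B0 \<alpha> \<beta>. \<exists>h g a b. canonical_rep f h g \<and>
        series_from_2 (\<lambda>z. h z - z) a \<and> series_from_2 g b \<and> cmod (a n) = c n" if "n \<ge> 2" for n
    \<comment> \<open>The joint bound holds with equality here, and \<open>c n > 0\<close> makes the
      modulus of the coefficient equal to \<open>c n\<close>.\<close>
    using extremal[OF that, of "of_real (c n)" 0] c[OF that] by fastforce
  moreover have "\<exists>f\<in>B0 \<alpha> \<beta>. \<exists>h g a b. canonical_rep f h g \<and>
        series_from_2 (\<lambda>z. h z - z) a \<and> series_from_2 g b \<and> cmod (b n) = c n" if "n \<ge> 2" for n
    using extremal[OF that, of 0 "of_real (c n)"] c[OF that] by fastforce
  ultimately show ?thesis
    using B0_coeff_bounds[OF assms(1)] unfolding c_def by blast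
qed

end
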